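(* Let $p\ge 2$ be an even integer and let $D_p(c)=(c-1)^4-4p(c+1)^2(c-p-1)$. Let $c^*$ be the unique solution of $D_p(c)=0$ in the interval $[2p+1+\sqrt{8p},\infty)$. The algorithm $\mathcal{A}$ for even $p$ described in the context (multimodal search for even $p$), run with parameters $$a=\frac{(c^*-1)^2}{2p(c^*+1)},\qquad r=\frac{\sqrt{\left(p(a^2-1)+2\right)^2+8p(a^2-1)(a-1)}-2}{4(a^2-1)}-\frac p4,$$ has competitive ratio $CR_{\mathcal{A}}=c^*$.
   Context: **Problem.** A point-like searcher starts at the origin of the real line at time $0$ and moves with speed at most $1$. A stationary target is at an unknown coordinate at distance $d\ge 1$ from the origin. The searcher has $p$ search modes, and a target is detected only when the searcher passes through its location in the (unknown) correct mode. The searcher may switch direction and mode instantaneously. A coordinate $x$ is *explored* by time $t$ if the searcher has passed through $x$ in each of the $p$ modes at or before time $t$. By convention every $x$ with $|x|<1$ counts as explored at time $0$. Infinitely precise motion, obtained as a limit of back-and-forth motion on arbitrarily small cells, is permitted. **Competitive ratio.** For an algorithm $\mathcal{A}$ (analyzed as if it never stops), let $T_{\mathcal{A}}(x)=\inf\{t\ge 0: x \text{ is explored by time } t\}$, $CR_{\mathcal{A}}(x)=T_{\mathcal{A}}(x)/|x|$, and $CR_{\mathcal{A}}=\sup_x CR_{\mathcal{A}}(x)$, the supremum being effectively over $|x|\ge 1$. **CellSearch.** CellSearch$(x_{init},\delta,p)$, called when the searcher is at $x_{init}\ne0$: for $i=0,\dots,p-1$ in order, the searcher travels at speed $1$ from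 its current position $y$ to $y+(-1)^i\delta\cdot\mathrm{sign}(x_{init})$ while searching in mode $i$. (For even $p$ it ends at $x_{init}$.) **ThoroughSearch for even $p$.** ThoroughSearch$(x_{init},\delta,p)$, called when the searcher is at $x_{init}\neq 0$: the searcher travels from $x_{init}$ to $x_{init}+\delta\cdot\mathrm{sign}(x_{init})$ at constant speed $\frac1{p+1}$ while searching in all $p$ modes simultaneously, so each point is explored when it is reached. (This is the limit, as the cell size tends to $0$, of applying CellSearch to successive small cells and crossing each cell one extra time.) **Algorithm for even $p$** (input: $p$, a growth factor $a>1$ and a coefficient $0\le r\le 1$). For rounds $i=0,1,2,\dots$: set $x_{start}=(-1)^i a^{i-1}$, $x_{end}=(-1)^i a^{i+1}$, $x_{mid}=(1-r)x_{start}+r\,x_{end}$; go from the origin to $x_{start}$ at speed $1$; call ThoroughSearch$(x_{start},|x_{mid}-x_{start}|,p)$; call CellSearch$(x_{mid},|x_{end}-x_{mid}|,p)$; return to the origin at speed $1$. *)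

theory Defs
  imports "HOL-Library.Extended_Real"
begin

text \<open>
  A trajectory on the real line is a sequence of legs. On each leg the searcher moves with constant
  speed from \<open>src\<close> to \<open>dst\<close>, searching simultaneously in all modes in \<open>modes\<close> (possibly none).
\<close>

datatype leg = Leg (src: real) (dst: real) (speed: real) (modes: "nat set")

definition dur :: "leg \<Rightarrow> real" where
  "dur l = \<bar>dst l - src l\<bar> / speed l"

definition pos :: "leg \<Rightarrow> real \<Rightarrow> real" where
  "pos l u = src l + sgn (dst l - src l) * speed l * u"

definition total_dur :: "leg list \<Rightarrow> real" where
  "total_dur ls = sum_list (map dur ls)"

text \<open>
  \<open>scans ls x m t\<close>: executing \<open>ls\<close> from time 0, the searcher is at \<open>x\<close> in mode \<open>m\<close> at time \<open>t\<close>.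
  Legs include both endpoints, so at a switching instant the old and the new mode are both active.
\<close>

definition scans :: "leg list \<Rightarrow> real \<Rightarrow> nat \<Rightarrow> real \<Rightarrow> bool" where
  "scans ls x m t \<longleftrightarrow>
     (\<exists>j<length ls. m \<in> modes (ls ! j) \<and>
        (\<exists>u. 0 \<le> u \<and> u \<le> dur (ls ! j) \<and> pos (ls ! j) u = x \<and> t = total_dur (take j ls) + u))"

text \<open>An algorithm is given by the legs \<open>A i\<close> of each round \<open>i = 0, 1, 2, \<dots>\<close>; it never stops.\<close>

definition explored_by :: "nat \<Rightarrow> (nat \<Rightarrow> leg list) \<Rightarrow> real \<Rightarrow> real \<Rightarrow> bool" where
  "explored_by p A x t \<longleftrightarrow>
     \<bar>x\<bar> < 1 \<or> (\<forall>m<p. \<exists>s\<le>t. \<exists>n. scans (concat (map A [0..<n])) x m s)"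

definition exploration_time :: "nat \<Rightarrow> (nat \<Rightarrow> leg list) \<Rightarrow> real \<Rightarrow> ereal" where
  "exploration_time p A x = (INF t\<in>{t. 0 \<le> t \<and> explored_by p A x t}. ereal t)"

text \<open>
  The exploration time is 0 for \<open>\<bar>x\<bar> < 1\<close>, so these points (including \<open>x = 0\<close>, where the quotient
  \<open>0 / 0\<close> is 0) do not affect the supremum.
\<close>

definition competitive_ratio :: "nat \<Rightarrow> (nat \<Rightarrow> leg list) \<Rightarrow> ereal" where
  "competitive_ratio p A = (SUP x. exploration_time p A x / ereal \<bar>x\<bar>)"

text \<open>\<open>cell_pos x \<delta> i\<close> is the searcher's position after the first \<open>i\<close> sweeps of a cell search.\<close>

primrec cell_pos :: "real \<Rightarrow> real \<Rightarrow> nat \<Rightarrow> real" where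
  "cell_pos x \<delta> 0 = x"
| "cell_pos x \<delta> (Suc i) = cell_pos x \<delta> i + (-1) ^ i * \<delta> * sgn x"

definition cell_search :: "real \<Rightarrow> real \<Rightarrow> nat \<Rightarrow> leg list" where
  "cell_search x \<delta> p = map (\<lambda>i. Leg (cell_pos x \<delta> i) (cell_pos x \<delta> (Suc i)) 1 {i}) [0..<p]"

definition thorough_search_even :: "real \<Rightarrow> real \<Rightarrow> nat \<Rightarrow> leg list" where
  "thorough_search_even x \<delta> p = [Leg x (x + \<delta> * sgn x) (1 / (real p + 1)) {..<p}]"

text \<open>
  The trips from and to the origin are made without searching: they only cross points that are
  already explored.
\<close>

definition even_algorithm :: "nat \<Rightarrow> real \<Rightarrow> real \<Rightarrow> nat \<Rightarrow> leg list" where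
  "even_algorithm p a r i =
     (let x_start = (-1) ^ i * a powi (int i - 1);
          x_end = (-1) ^ i * a powi (int i + 1);
          x_mid = (1 - r) * x_start + r * x_end;
          \<delta> = \<bar>x_end - x_mid\<bar>
      in [Leg 0 x_start 1 {}]
         @ thorough_search_even x_start \<bar>x_mid - x_start\<bar> p
         @ cell_search x_mid \<delta> p
         @ [Leg (cell_pos x_mid \<delta> p) 0 1 {}])"

definition D :: "nat \<Rightarrow> real \<Rightarrow> real" where
  "D p c = (c - 1) ^ 4 - 4 * real p * (c + 1) ^ 2 * (c - real p - 1)"

end

theory Submission
  imports Defs
begin

text \<open>
  In a late round \<open>i\<close>, of duration \<open>K s\<close> with \<open>s = a ^ (i - 1)\<close>, the ratio decreases along each of the
  two searched segments, so only their inner ends matter. As \<open>i\<close> grows the ratio there increases to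
  \<open>1 + K / (a - 1)\<close> and \<open>1 + (K / (a - 1) + p (a\<^sup>2 - 1)) / m\<close> respectively, where
  \<open>m = 1 + r (a\<^sup>2 - 1)\<close>. The parameter \<open>r\<close> makes the two limits equal to \<open>1 + p / r\<close>, and
  \<open>D p c = 0\<close> says that this value is \<open>c\<close>.
\<close>

section \<open>Trajectories\<close>

lemma total_dur_simps [simp]:
  "total_dur [] = 0"
  "total_dur (l # ls) = dur l + total_dur ls"
  "total_dur (xs @ ys) = total_dur xs + total_dur ys"
  by (simp_all add: total_dur_def)

lemma scans_Nil [simp]: "\<not> scans [] x m t"
  by (simp add: scans_def)

text \<open>Peeling off the first leg turns the index \<open>j\<close> of \<open>scans\<close> into
  list recursion; everything later uses this form.\<close>

lemma scans_Cons:
  "scans (l # ls) x m t \<longleftrightarrow>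
     m \<in> modes l \<and> 0 \<le> t \<and> t \<le> dur l \<and> pos l t = x \<or> scans ls x m (t - dur l)"
  (is "?L \<longleftrightarrow> ?A \<or> ?R")
proof
  assume ?L
  then obtain j u where j: "j < Suc (length ls)" "m \<in> modes ((l # ls) ! j)" "0 \<le> u"
    "u \<le> dur ((l # ls) ! j)" "pos ((l # ls) ! j) u = x" "t = total_dur (take j (l # ls)) + u"
    unfolding scans_def by auto
  show "?A \<or> ?R"
  proof (cases j)
    case 0
    then show ?thesis using j by simp
  next
    case (Suc k)
    then have ?R unfolding scans_def using j by (intro exI[of _ k]) auto
    then show ?thesis ..
  qed
next
  assume "?A \<or> ?R"
  then show ?L
  proof
    assume ?A
    then show ?L unfolding scans_def by (intro exI[of _ 0]) auto
  next
    assume ?R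
    then obtain j u where j: "j < length ls" "m \<in> modes (ls ! j)" "0 \<le> u"
      "u \<le> dur (ls ! j)" "pos (ls ! j) u = x" "t - dur l = total_dur (take j ls) + u"
      unfolding scans_def by auto
    then show ?L unfolding scans_def by (intro exI[of _ "Suc j"]) auto
  qed
qed

lemma scans_append:
  "scans (xs @ ys) x m t \<longleftrightarrow> scans xs x m t \<or> scans ys x m (t - total_dur xs)"
  by (induction xs arbitrary: t) (auto simp: scans_Cons algebra_simps)

lemma scans_concat_map:
  "scans (concat (map A [0..<n])) x m t \<longleftrightarrow>
     (\<exists>i<n. scans (A i) x m (t - total_dur (concat (map A [0..<i]))))"
  by (induction n) (auto simp: scans_append less_Suc_eq)

lemma scans_map:
  "scans (map f [0..<n]) x m t \<longleftrightarrow>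
     (\<exists>i<n. scans [f i] x m (t - total_dur (map f [0..<i])))"
  by (induction n) (auto simp: scans_append less_Suc_eq)

lemma scans_leg_between:
  assumes "scans [l] x m t" "speed l > 0"
  shows "m \<in> modes l" "0 \<le> t" "min (src l) (dst l) \<le> x" "x \<le> max (src l) (dst l)"
proof -
  have *: "m \<in> modes l" "0 \<le> t" "t \<le> dur l" "pos l t = x"
    using assms(1) by (auto simp: scans_Cons)
  have "speed l * t \<le> \<bar>dst l - src l\<bar>" "0 \<le> speed l * t"
    using * assms(2) by (auto simp: dur_def field_simps)
  with * show "m \<in> modes l" "0 \<le> t" "min (src l) (dst l) \<le> x" "x \<le> max (src l) (dst l)"
    by (auto simp: pos_def sgn_if split: if_splits)
qed

lemma scans_legI:
  assumes "m \<in> modes l" "speed l > 0" "min (src l) (dst l) \<le> x" "x \<le> max (src l) (dst l)"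
  shows "scans [l] x m (\<bar>x - src l\<bar> / speed l)"
proof -
  have "\<bar>x - src l\<bar> \<le> \<bar>dst l - src l\<bar>" "sgn (dst l - src l) * \<bar>x - src l\<bar> = x - src l"
    using assms(3,4) by (auto simp: sgn_if)
  with assms(1,2) show ?thesis
    by (auto simp: scans_Cons dur_def pos_def divide_right_mono)
qed

section \<open>One round\<close>

text \<open>Normal form of a round. The sign \<open>\<sigma>\<close> is factored out, so that
  \<open>s\<close>, \<open>M\<close>, \<open>e\<close> are distances from the origin and one
  computation serves both half-lines. Alternation of the sweeps is expressed by the parity of
  \<open>k\<close>.\<close>

definition round_legs :: "nat \<Rightarrow> real \<Rightarrow> real \<Rightarrow> real \<Rightarrow> real \<Rightarrow> leg list" where
  "round_legs p \<sigma> s M e =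
     [Leg 0 (\<sigma> * s) 1 {}, Leg (\<sigma> * s) (\<sigma> * M) (1 / (real p + 1)) {..<p}]
     @ map (\<lambda>k. Leg (\<sigma> * (if even k then M else e)) (\<sigma> * (if even k then e else M)) 1 {k}) [0..<p]
     @ [Leg (\<sigma> * M) 0 1 {}]"

lemma cell_pos_eq: "cell_pos x \<delta> i = (if even i then x else x + \<delta> * sgn x)"
  by (induction i) auto

lemma total_dur_sweeps:
  assumes "\<bar>\<sigma>\<bar> = 1" "M \<le> e"
  shows "total_dur (map (\<lambda>k. Leg (\<sigma> * (if even k then M else e)) (\<sigma> * (if even k then e else M)) 1 {k}) [0..<n])
    = real n * (e - M)"
  using assms
  by (induction n) (auto simp: dur_def algebra_simps abs_if split: if_splits)

text \<open>The phases last \<open>s\<close>, \<open>(p + 1) * (M - s)\<close>,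
  \<open>p * (e - M)\<close> and \<open>M\<close>.\<close>

lemma total_dur_round_legs:
  assumes "\<bar>\<sigma>\<bar> = 1" "0 < s" "s \<le> M" "M \<le> e"
  shows "total_dur (round_legs p \<sigma> s M e) = 2 * M + real p * (e - s)"
proof -
  have d: "dur (Leg 0 (\<sigma> * s) 1 {}) = s" "dur (Leg (\<sigma> * M) 0 1 {}) = M"
    using assms by (auto simp: dur_def abs_mult)
  have "\<bar>\<sigma> * M - \<sigma> * s\<bar> = M - s"
    using assms by (simp flip: right_diff_distrib add: abs_mult)
  then have "dur (Leg (\<sigma> * s) (\<sigma> * M) (1 / (real p + 1)) {..<p}) = (real p + 1) * (M - s)"
    by (simp add: dur_def)
  with d assms show ?thesis
    by (simp only: round_legs_def total_dur_simps total_dur_sweeps) (simp add: algebra_simps)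
qed

lemma even_algorithm_eq_round_legs:
  assumes "even p" "1 < a" "0 \<le> r" "r \<le> 1"
    and s: "s = a powi (int i - 1)" and e: "e = a powi (int i + 1)" and M: "M = (1 - r) * s + r * e"
  shows "even_algorithm p a r i = round_legs p ((-1) ^ i) s M e"
    and "0 < s" "s \<le> M" "M \<le> e"
proof -
  show s0: "0 < s" using assms by simp
  have se: "s \<le> e" unfolding s e using assms by (intro power_int_increasing) auto
  have "M - s = r * (e - s)" "e - M = (1 - r) * (e - s)" by (simp_all add: M algebra_simps)
  then have "0 \<le> M - s" "0 \<le> e - M" using se assms by auto
  then show sM: "s \<le> M" and Me: "M \<le> e" by auto
  define \<sigma> :: real where "\<sigma> = (-1) ^ i"
  have sg: "\<sigma> = 1 \<or> \<sigma> = -1" by (cases "even i") (auto simp: \<sigma>_def)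
  have xm: "(1 - r) * (\<sigma> * s) + r * (\<sigma> * e) = \<sigma> * M" by (simp add: M algebra_simps)
  have sgs: "sgn (\<sigma> * s) = \<sigma>" "sgn (\<sigma> * M) = \<sigma>" using sg s0 sM by auto
  have d1: "\<bar>\<sigma> * M - \<sigma> * s\<bar> = M - s" "\<bar>\<sigma> * e - \<sigma> * M\<bar> = e - M" using sg sM Me by auto
  have A: "thorough_search_even (\<sigma> * s) (M - s) p = [Leg (\<sigma> * s) (\<sigma> * M) (1 / (real p + 1)) {..<p}]"
    by (simp add: thorough_search_even_def sgs algebra_simps)
  have cp: "cell_pos (\<sigma> * M) (e - M) k = \<sigma> * (if even k then M else e)" for k
    by (simp only: cell_pos_eq sgs) (simp add: algebra_simps)
  have B: "cell_search (\<sigma> * M) (e - M) p =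
      map (\<lambda>k. Leg (\<sigma> * (if even k then M else e)) (\<sigma> * (if even k then e else M)) 1 {k}) [0..<p]"
    unfolding cell_search_def cp by (rule map_cong) auto
  \<comment> \<open>Evenness of \<open>p\<close> enters here: after \<open>p\<close> sweeps the cell
    search is back at \<open>M\<close>, where the return leg of \<open>round_legs\<close>
    starts.\<close>
  show "even_algorithm p a r i = round_legs p ((-1) ^ i) s M e"
    unfolding even_algorithm_def Let_def s[symmetric] e[symmetric] \<sigma>_def[symmetric] xm d1 A B cp
    using assms(1) by (simp add: round_legs_def)
qed

text \<open>The trips from and to the origin carry no modes and contribute only their durations, so
  a scan falls into the slow leg or into a sweep.\<close>

lemma scans_round_legs:
  assumes "\<bar>\<sigma>\<bar> = 1" "0 < s" "s \<le> M"
  shows "scans (round_legs p \<sigma> s M e) x m t \<longleftrightarrow>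
    scans [Leg (\<sigma> * s) (\<sigma> * M) (1 / (real p + 1)) {..<p}] x m (t - s) \<or>
    scans (map (\<lambda>k. Leg (\<sigma> * (if even k then M else e)) (\<sigma> * (if even k then e else M)) 1 {k}) [0..<p])
      x m (t - s - (real p + 1) * (M - s))"
proof -
  have "dur (Leg 0 (\<sigma> * s) 1 {}) = s" using assms by (auto simp: dur_def abs_mult)
  moreover have "\<bar>\<sigma> * M - \<sigma> * s\<bar> = M - s"
    using assms by (simp flip: right_diff_distrib add: abs_mult)
  then have "dur (Leg (\<sigma> * s) (\<sigma> * M) (1 / (real p + 1)) {..<p}) = (real p + 1) * (M - s)"
    by (simp add: dur_def)
  ultimately show ?thesis
    unfolding round_legs_def scans_append by (simp add: scans_Cons diff_diff_eq)
qed

text \<open>Serves the lower bound on the ratio. The crude bound \<open>s \<le> t\<close> is enough,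
  because the extremal points lie just beyond \<open>s\<close>, where the slow leg has only
  begun.\<close>

lemma scans_round_legs_bounds:
  assumes "\<sigma> = 1 \<or> \<sigma> = -1" "0 < s" "s \<le> M" "M \<le> e"
    and "scans (round_legs p \<sigma> s M e) x m t"
  shows "s \<le> t" "0 < \<sigma> * x" "\<sigma> * x \<le> e"
proof -
  let ?f = "\<lambda>k. Leg (\<sigma> * (if even k then M else e)) (\<sigma> * (if even k then e else M)) 1 {k}"
  let ?l = "Leg (\<sigma> * s) (\<sigma> * M) (1 / (real p + 1)) {..<p}"
  have "\<bar>\<sigma>\<bar> = 1" using assms(1) by auto
  then consider "scans [?l] x m (t - s)"
    | "scans (map ?f [0..<p]) x m (t - s - (real p + 1) * (M - s))"
    using assms scans_round_legs[of \<sigma> s M p e x m t] by blast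
  then have "s \<le> t \<and> 0 < \<sigma> * x \<and> \<sigma> * x \<le> e"
  proof cases
    case 1
    then show ?thesis
      using scans_leg_between[OF 1] assms by auto
  next
    case 2
    then obtain k where k: "scans [?f k] x m (t - s - (real p + 1) * (M - s) - total_dur (map ?f [0..<k]))"
      by (subst (asm) scans_map) auto
    have td: "total_dur (map ?f [0..<k]) \<ge> 0"
      using assms by (subst total_dur_sweeps) auto
    have "0 \<le> (real p + 1) * (M - s)" using assms by simp
    then have "s \<le> t" using scans_leg_between(2)[OF k] td by simp
    then show ?thesis
      using scans_leg_between(3,4)[OF k] assms by (auto split: if_splits)
  qed
  then show "s \<le> t" "0 < \<sigma> * x" "\<sigma> * x \<le> e" by auto
qed

lemma scans_round_legs_thorough:
  assumes "\<sigma> = 1 \<or> \<sigma> = -1" "0 < s" "s \<le> y" "y \<le> M" "m < p"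
  shows "scans (round_legs p \<sigma> s M e) (\<sigma> * y) m (s + (real p + 1) * (y - s))"
proof -
  let ?l = "Leg (\<sigma> * s) (\<sigma> * M) (1 / (real p + 1)) {..<p}"
  have "scans [?l] (\<sigma> * y) m (\<bar>\<sigma> * y - src ?l\<bar> / speed ?l)"
    using assms by (intro scans_legI) auto
  moreover have "\<bar>\<sigma> * y - src ?l\<bar> / speed ?l = (real p + 1) * (y - s)"
    using assms by (auto simp: algebra_simps)
  ultimately have "scans [?l] (\<sigma> * y) m ((real p + 1) * (y - s))" by (simp only:)
  then show ?thesis
    using assms by (subst scans_round_legs) auto
qed

text \<open>For even \<open>p\<close> the last sweep is a backward one, so it fixes the exploration time.\<close>

lemma scans_round_legs_cell:
  assumes "\<sigma> = 1 \<or> \<sigma> = -1" "0 < s" "s \<le> M" "M \<le> y" "y \<le> e" "m < p" "even p"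
  obtains t where "scans (round_legs p \<sigma> s M e) (\<sigma> * y) m t"
    and "t \<le> M + real p * (e - s) - (y - M)"
proof -
  let ?f = "\<lambda>k. Leg (\<sigma> * (if even k then M else e)) (\<sigma> * (if even k then e else M)) 1 {k}"
  \<comment> \<open>Even sweeps run outward from \<open>M\<close>, odd ones inward from
    \<open>e\<close>.\<close>
  let ?u = "if even m then y - M else e - y"
  let ?t = "s + (real p + 1) * (M - s) + real m * (e - M) + ?u"
  have "scans [?f m] (\<sigma> * y) m (\<bar>\<sigma> * y - src (?f m)\<bar> / speed (?f m))"
    using assms by (intro scans_legI) auto
  moreover have "\<bar>\<sigma> * y - src (?f m)\<bar> / speed (?f m) = ?u"
    using assms by auto
  ultimately have "scans [?f m] (\<sigma> * y) m ?u" by simp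
  moreover have "total_dur (map ?f [0..<m]) = real m * (e - M)"
    using assms by (intro total_dur_sweeps) auto
  ultimately have "scans (map ?f [0..<p]) (\<sigma> * y) m (real m * (e - M) + ?u)"
    using assms(6) by (subst scans_map) (auto intro!: exI[of _ m])
  then have sc: "scans (round_legs p \<sigma> s M e) (\<sigma> * y) m ?t"
    using assms by (subst scans_round_legs) auto
  \<comment> \<open>Equality holds for the last sweep \<open>m = p - 1\<close>, which is odd. An
    even \<open>m\<close> is at most \<open>p - 2\<close>, and the two spare sweeps pay for
    replacing \<open>y - M\<close> by its negative.\<close>
  have "real m * (e - M) + ?u \<le> real p * (e - M) - (y - M)"
  proof (cases "even m")
    case True
    then have "real m + 2 \<le> real p" using assms by (auto elim!: evenE)
    then have "(real m + 2) * (e - M) \<le> real p * (e - M)"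
      using assms by (intro mult_right_mono) auto
    moreover have "(real m + 2) * (e - M) = real m * (e - M) + 2 * (e - M)" by (simp add: algebra_simps)
    ultimately show ?thesis using True assms by simp
  next
    case False
    have "real m + 1 \<le> real p" using assms by auto
    then have "(real m + 1) * (e - M) \<le> real p * (e - M)"
      using assms by (intro mult_right_mono) auto
    then show ?thesis using False by (simp add: algebra_simps)
  qed
  then have "?t \<le> M + real p * (e - s) - (y - M)" by (simp add: algebra_simps)
  with sc show ?thesis by (rule that)
qed

section \<open>The competitive ratio\<close>

lemma exploration_time_le: "0 \<le> t \<Longrightarrow> explored_by p A x t \<Longrightarrow> exploration_time p A x \<le> ereal t"
  unfolding exploration_time_def by (auto intro: INF_lower)

lemma competitive_ratio_le:
  assumes "0 \<le> c" "\<And>x. 1 \<le> \<bar>x\<bar> \<Longrightarrow> explored_by p A x (c * \<bar>x\<bar>)"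
  shows "competitive_ratio p A \<le> ereal c"
  unfolding competitive_ratio_def
proof (rule SUP_least)
  fix x :: real
  show "exploration_time p A x / ereal \<bar>x\<bar> \<le> ereal c"
  proof (cases "\<bar>x\<bar> < 1")
    case True
    then have "exploration_time p A x \<le> ereal 0"
      by (intro exploration_time_le) (auto simp: explored_by_def)
    moreover have "ereal 0 \<le> exploration_time p A x"
      unfolding exploration_time_def by (rule INF_greatest) auto
    ultimately have "exploration_time p A x = 0" by (simp add: zero_ereal_def)
    then show ?thesis using assms(1) by simp
  next
    case False
    then have "exploration_time p A x \<le> ereal (c * \<bar>x\<bar>)"
      using assms by (intro exploration_time_le) auto
    then show ?thesis using False
      by (subst ereal_divide_le_pos) (auto simp: mult.commute)
  qed
qed

lemma le_competitive_ratio: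
  assumes "1 \<le> \<bar>x\<bar>" "\<And>t. explored_by p A x t \<Longrightarrow> q \<le> t"
  shows "ereal (q / \<bar>x\<bar>) \<le> competitive_ratio p A"
proof -
  have "ereal q \<le> exploration_time p A x"
    unfolding exploration_time_def using assms by (intro INF_greatest) auto
  then have "ereal (q / \<bar>x\<bar>) \<le> exploration_time p A x / ereal \<bar>x\<bar>"
    using assms(1) by (subst ereal_le_divide_pos) auto
  also have "\<dots> \<le> competitive_ratio p A"
    unfolding competitive_ratio_def by (rule SUP_upper) simp
  finally show ?thesis .
qed

section \<open>Geometric growth of the rounds\<close>

lemma powi_shift:
  fixes a :: real assumes "a > 0"
  shows "a powi (int i - 1) = a ^ i / a" "a powi (int i + 1) = a ^ i * a"
  using assms by (simp_all add: power_int_diff power_int_add)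

text \<open>Rounds of equal parity visit abutting intervals: the outer end of one is the inner end
  of the next. Hence minimality of \<open>k\<close> gives the lower bound on \<open>y\<close>; for
  \<open>k = 0\<close> it follows from \<open>a ^ b / a \<le> 1\<close>.\<close>

lemma growing_interval_cover:
  fixes a y :: real
  assumes "1 < a" "1 \<le> y" "b \<le> 1"
  obtains i where "even i = even (b::nat)" "a ^ i / a \<le> y" "y \<le> a ^ i * a"
proof -
  define P where "P k \<longleftrightarrow> y \<le> a ^ (2 * k + b) * a" for k
  obtain n where n: "y < a ^ n" using real_arch_pow[OF assms(1)] by blast
  also have "a ^ n \<le> a ^ (2 * n + b + 1)" using assms by (intro power_increasing) auto
  finally have "P n" by (simp add: P_def mult.commute)
  define k where "k = (LEAST k. P k)"
  have k: "P k" unfolding k_def using \<open>P n\<close> by (rule LeastI)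
  have "a ^ (2 * k + b) / a \<le> y"
  proof (cases k)
    case 0
    have "a ^ b \<le> a ^ 1" using assms by (intro power_increasing) auto
    then have "a ^ b / a \<le> 1" using assms by simp
    then have "a ^ b / a \<le> y" using assms(2) by linarith
    then show ?thesis using 0 by simp
  next
    case (Suc j)
    then have "\<not> P j" unfolding k_def by (metis lessI not_less_Least)
    then show ?thesis using Suc assms by (simp add: P_def field_simps)
  qed
  then show ?thesis using k by (intro that[of "2 * k + b"]) (auto simp: P_def)
qed

text \<open>\<open>balance\<close> says that \<open>K / (a - 1) = p / r\<close> for the round
  duration \<open>K * s i\<close>. This makes the total time before a round a geometric sum with
  factor \<open>c - 1\<close>, and the choice of \<open>M\<close> turns the same factor into the
  bound at \<open>M i\<close>.\<close>

lemma competitive_ratio_even_algorithm: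
  assumes p: "even p" "2 \<le> p" and a: "1 < a" and r: "0 < r" "r \<le> 1"
    and balance: "r * (2 + (2 * r + real p) * (a\<^sup>2 - 1)) = real p * (a - 1)"
  shows "competitive_ratio p (even_algorithm p a r) = ereal (1 + real p / r)"
proof -
  define c where "c = 1 + real p / r"
  define K where "K = 2 + (2 * r + real p) * (a\<^sup>2 - 1)"
  define s where "s i = a ^ i / a" for i :: nat
  define e where "e i = a ^ i * a" for i :: nat
  define M where "M i = (1 - r) * s i + r * e i" for i
  define S where "S n = total_dur (concat (map (even_algorithm p a r) [0..<n]))" for n
  have pr: "real p \<le> real p / r" using r by (simp add: field_simps mult_left_le_one_le)
  have c1: "c - 1 = real p / r" by (simp add: c_def)
  have cp: "real p + 1 \<le> c" using pr by (simp add: c_def)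
  have Kc: "K = (c - 1) * (a - 1)"
    using balance r unfolding K_def c1 by (simp add: field_simps)
  have rounds: "even_algorithm p a r i = round_legs p ((-1) ^ i) (s i) (M i) (e i)"
    "0 < s i" "s i \<le> M i" "M i \<le> e i" for i
    using even_algorithm_eq_round_legs[of p a r "s i" i "e i" "M i"] p a r
    by (auto simp: s_def e_def M_def powi_shift)
  have sgn: "(-1) ^ i = (1::real) \<or> (-1) ^ i = (-1::real)" for i :: nat
    by (cases "even i") auto
  have es: "e i = a\<^sup>2 * s i" for i using a by (simp add: e_def s_def power2_eq_square)
  have M': "M i = s i * (1 + r * (a\<^sup>2 - 1))" for i by (simp add: M_def es algebra_simps)
  have "total_dur (even_algorithm p a r i) = 2 * M i + real p * (e i - s i)" for i
    unfolding rounds(1) using rounds(2-4)[of i] sgn[of i] by (intro total_dur_round_legs) auto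
  then have dur_round: "total_dur (even_algorithm p a r i) = K * s i" for i
    by (simp add: M' es K_def algebra_simps)
  \<comment> \<open>The sum telescopes because \<open>K = (c - 1) * (a - 1)\<close> and
    \<open>s (Suc n) = a * s n\<close>. The correction \<open>1 / a\<close> is \<open>s 0\<close>;
    it keeps the ratio below \<open>c\<close> in each round and vanishes relative to
    \<open>s n\<close>.\<close>
  have S_eq: "S n = (c - 1) * (s n - 1 / a)" for n
  proof (induction n)
    case 0
    then show ?case by (simp add: S_def s_def)
  next
    case (Suc n)
    have "S (Suc n) = S n + K * s n" by (simp add: S_def dur_round)
    also have "\<dots> = (c - 1) * (s (Suc n) - 1 / a)"
      unfolding Suc Kc using a by (simp add: s_def field_simps)
    finally show ?case .
  qed
  have s_mono: "s i \<le> s j" if "i \<le> j" for i j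
    unfolding s_def using a that by (intro divide_right_mono power_increasing) auto
  have "1 \<le> c" using cp by simp
  have S_mono: "S i \<le> S j" if "i \<le> j" for i j
    unfolding S_eq using s_mono[OF that] \<open>1 \<le> c\<close> by (intro mult_left_mono) auto
  have S_le: "S i \<le> (c - 1) * s i" for i
    unfolding S_eq using a \<open>1 \<le> c\<close> by (intro mult_left_mono) auto

  have upper: "competitive_ratio p (even_algorithm p a r) \<le> ereal c"
  proof (rule competitive_ratio_le)
    show "0 \<le> c" using \<open>1 \<le> c\<close> by simp
    fix x :: real assume x: "1 \<le> \<bar>x\<bar>"
    define y where "y = \<bar>x\<bar>"
    define b :: nat where "b = (if x > 0 then 0 else 1)"
    have "1 \<le> y" "b \<le> 1" using x by (auto simp: y_def b_def)
    then obtain i where i: "even i = even b" "s i \<le> y" "y \<le> e i"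
      unfolding s_def e_def by (rule growing_interval_cover[OF a])
    have xy: "x = (-1) ^ i * y"
      using i(1) x by (auto simp: b_def y_def split: if_splits)
    \<comment> \<open>Round \<open>i\<close> starts at time \<open>S i\<close>, so
      \<open>c * y - S i\<close> is the time left for it.\<close>
    have scan: "\<exists>t. t \<le> c * y - S i \<and> scans (even_algorithm p a r i) x m t" if m: "m < p" for m
    proof (cases "y \<le> M i")
      case True
      \<comment> \<open>At \<open>y = s i\<close> the bound is \<open>S_le\<close>; beyond it the
        scanning time grows with slope \<open>p + 1\<close>, the allowance with slope
        \<open>c\<close>.\<close>
      have "(real p + 1) * (y - s i) \<le> c * (y - s i)" using cp i by (intro mult_right_mono) auto
      then have "s i + (real p + 1) * (y - s i) \<le> c * y - S i"
        using S_le[of i] by (simp add: algebra_simps)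
      then show ?thesis
        unfolding rounds(1) xy
        using scans_round_legs_thorough[OF sgn[of i] rounds(2)[of i] i(2) True m] by blast
    next
      case False
      then have "M i \<le> y" by simp
      from scans_round_legs_cell[OF sgn[of i] rounds(2,3)[of i] this i(3) m p(1)]
      obtain t where t: "scans (even_algorithm p a r i) x m t"
        "t \<le> M i + real p * (e i - s i) - (y - M i)"
        unfolding rounds(1) xy by blast
      \<comment> \<open>Follows from \<open>M i - s i = r * (e i - s i)\<close> and
        \<open>(c - 1) * r = p\<close>. It settles \<open>y = M i\<close>; for larger
        \<open>y\<close> the time bound falls while \<open>c * y\<close> rises.\<close>
      have "(c - 1) * M i = (c - 1) * s i + real p * (e i - s i)"
        unfolding M' es c1 using r by (simp add: field_simps)
      moreover have "c * M i \<le> c * y" using False \<open>1 \<le> c\<close> by (intro mult_left_mono) auto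
      ultimately have "M i + real p * (e i - s i) - (y - M i) \<le> c * y - S i"
        using S_le[of i] False by (simp add: algebra_simps)
      then show ?thesis using t by (intro exI[of _ t]) simp
    qed
    have "\<exists>t'\<le>c * y. \<exists>n. scans (concat (map (even_algorithm p a r) [0..<n])) x m t'"
      if "m < p" for m
    proof -
      obtain t where t: "t \<le> c * y - S i" "scans (even_algorithm p a r i) x m t"
        using scan[OF \<open>m < p\<close>] by blast
      have "scans (concat (map (even_algorithm p a r) [0..<Suc i])) x m (t + S i)"
        unfolding scans_concat_map using t by (intro exI[of _ i]) (auto simp: S_def)
      moreover have "t + S i \<le> c * y" using t by simp
      ultimately show ?thesis by blast
    qed
    then show "explored_by p (even_algorithm p a r) x (c * \<bar>x\<bar>)"
      by (auto simp: explored_by_def y_def)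
  qed

  \<comment> \<open>A point just beyond \<open>s i\<close> on the side of round \<open>i\<close>
    lies outside the reach of all earlier rounds on that side, so it waits for round
    \<open>i\<close>. Looking at mode \<open>0\<close> alone suffices.\<close>
  have far: "S i + s i \<le> t"
    if y: "s i < y" "1 \<le> y" and ex: "explored_by p (even_algorithm p a r) ((-1) ^ i * y) t" for i y t
  proof -
    have "\<not> \<bar>(-1) ^ i * y\<bar> < 1" using y by (auto simp: abs_mult)
    moreover have "0 < p" using p by simp
    ultimately obtain t' n where t': "t' \<le> t"
      "scans (concat (map (even_algorithm p a r) [0..<n])) ((-1) ^ i * y) 0 t'"
      using ex unfolding explored_by_def by blast
    then obtain j where j: "scans (even_algorithm p a r j) ((-1) ^ i * y) 0 (t' - S j)"
      unfolding scans_concat_map S_def by blast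
    note bounds = scans_round_legs_bounds[OF sgn[of j] rounds(2-4)[of j] j[unfolded rounds(1)]]
    have par: "even i = even j"
      using bounds(2) y by (auto split: if_splits simp: zero_less_mult_iff minus_one_power_iff)
    then have "y \<le> e j" using bounds(3) by (auto simp: minus_one_power_iff split: if_splits)
    \<comment> \<open>This bounds \<open>i\<close> by \<open>j + 1\<close>, and equal parity
      excludes \<open>i = j + 1\<close>.\<close>
    then have "s i < e j" using y(1) by simp
    then have "a ^ i < a ^ (j + 2)" using a by (simp add: s_def e_def field_simps)
    then have "i < j + 2" using a by (simp add: power_less_imp_less_exp)
    then have "i \<le> j" using par by presburger
    then show ?thesis using S_mono[of i j] s_mono[of i j] bounds(1) t'(1) by linarith
  qed

  have "\<not> competitive_ratio p (even_algorithm p a r) < ereal c"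
  proof
    assume less: "competitive_ratio p (even_algorithm p a r) < ereal c"
    have "1 < c" using cp p by simp
    \<comment> \<open>The maximum with \<open>1\<close> yields \<open>b > 1\<close>, which is used
      for dividing by \<open>b\<close> and for excluding \<open>i = 0\<close>.\<close>
    then have "max (competitive_ratio p (even_algorithm p a r)) (ereal 1) < ereal c" using less by simp
    from ereal_dense2[OF this]
    obtain b where "max (competitive_ratio p (even_algorithm p a r)) (ereal 1) < ereal b"
      "ereal b < ereal c" by blast
    then have b: "competitive_ratio p (even_algorithm p a r) < ereal b" "b < c" and b1: "1 < b"
      unfolding max_less_iff_conj less_ereal.simps by blast+
    \<comment> \<open>Since \<open>S i + s i = c * s i - (c - 1) / a\<close>, this choice makes the
      correction smaller than \<open>(c - b) * s i\<close>.\<close>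
    obtain i where i: "(c - 1) / (c - b) < a ^ i" using real_arch_pow[OF a] by blast
    have "1 < (c - 1) / (c - b)" using b b1 by (simp add: field_simps)
    then have "i \<noteq> 0" using i by (intro notI) simp
    then have "a ^ 1 \<le> a ^ i" using a by (intro power_increasing) auto
    then have s1: "1 \<le> s i" using a by (simp add: s_def)
    have "c - 1 < (c - b) * a ^ i" using i b by (simp add: pos_divide_less_eq mult.commute)
    then have "(c - 1) / a < (c - b) * s i"
      using divide_strict_right_mono[of "c - 1" "(c - b) * a ^ i" a] a by (simp add: s_def)
    then have "b * s i < S i + s i" by (simp add: S_eq algebra_simps diff_divide_distrib)
    then have "s i < (S i + s i) / b" using b1 by (simp add: field_simps)
    \<comment> \<open>The point \<open>s i\<close> itself may have been explored in round
      \<open>i - 2\<close>, so the ratio is tested slightly farther out.\<close>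
    then obtain y where y: "s i < y" "y < (S i + s i) / b" using dense by blast
    have y1: "1 \<le> y" using y s1 by simp
    have absy: "\<bar>(-1) ^ i * y\<bar> = y" using y1 by (simp add: abs_mult)
    have "ereal ((S i + s i) / \<bar>(-1) ^ i * y\<bar>) \<le> competitive_ratio p (even_algorithm p a r)"
      by (rule le_competitive_ratio) (use far[OF y(1) y1] y1 absy in auto)
    moreover have "b < (S i + s i) / y" using y b1 y1 by (simp add: field_simps)
    ultimately have "ereal b < competitive_ratio p (even_algorithm p a r)"
      unfolding absy by (metis less_ereal.simps(1) order_less_le_trans)
    then show False using b by simp
  qed
  with upper show ?thesis by (simp add: c_def)
qed

section \<open>The parameters\<close>

text \<open>With \<open>v = c - 1\<close> the squared term is
  \<open>v\<^sup>2 - 2 * p * (v + 2)\<close>, which is \<open>2 * p * (v + 2) * (a - 1)\<close> for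
  the growth factor \<open>a\<close> of the theorem. Its sign therefore decides whether
  \<open>1 < a\<close>.\<close>

lemma D_alt:
  "D p (v + 1) = (v\<^sup>2 - 2 * real p * v - 4 * real p)\<^sup>2 - 8 * real p * v * (v + 2)"
  by (simp add: D_def power2_eq_square power4_eq_xxxx algebra_simps)

text \<open>Both \<open>v\<close> and \<open>v - 2 * p\<close> are at least
  \<open>sqrt (8 * p)\<close>, so their product is at least \<open>8 * p\<close>.\<close>

lemma threshold_pos:
  fixes v p :: real
  assumes "2 \<le> p" "2 * p + sqrt (8 * p) \<le> v"
  shows "0 < v\<^sup>2 - 2 * p * v - 4 * p"
proof -
  have s: "sqrt (8 * p) * sqrt (8 * p) = 8 * p" "0 < sqrt (8 * p)" using assms by auto
  have v: "0 \<le> v" using assms s by linarith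
  have "8 * p \<le> sqrt (8 * p) * v"
    using mult_left_mono[of "sqrt (8 * p)" v "sqrt (8 * p)"] s assms by auto
  also have "\<dots> \<le> (v - 2 * p) * v"
    using assms v by (intro mult_right_mono) auto
  finally show ?thesis using assms by (simp add: power2_eq_square algebra_simps)
qed

text \<open>
  Division of \<open>D p (v + 1)\<close> by \<open>v\<^sup>2\<close> leaves the difference of an increasing and a
  decreasing function.
\<close>

lemma D_root_unique:
  assumes p: "2 \<le> p" and v: "2 * real p + sqrt (8 * real p) \<le> v" and vw: "v < w"
    and D: "D p (v + 1) = 0" "D p (w + 1) = 0"
  shows False
proof -
  have p0: "0 < real p" using p by simp
  have v0: "0 < v" using v p0 by (smt (verit) real_sqrt_ge_zero)
  define g where "g u = u - 2 * real p - 4 * real p / u" for u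
  have g: "(g u)\<^sup>2 = 8 * real p * (1 + 2 / u)" if "0 < u" "D p (u + 1) = 0" for u
  proof -
    have "u\<^sup>2 - 2 * real p * u - 4 * real p = u * g u"
      using that by (simp add: g_def field_simps power2_eq_square)
    then have "u\<^sup>2 * (g u)\<^sup>2 = 8 * real p * u * (u + 2)"
      using that(2) unfolding D_alt by (simp add: power_mult_distrib)
    also have "\<dots> = u\<^sup>2 * (8 * real p * (1 + 2 / u))"
      using that by (simp add: field_simps power2_eq_square)
    finally show ?thesis using that by simp
  qed
  have "v * g v = v\<^sup>2 - 2 * real p * v - 4 * real p"
    using v0 by (simp add: g_def field_simps power2_eq_square)
  \<comment> \<open>Positivity of \<open>g v\<close> is what lets \<open>g v < g w\<close> survive
    squaring.\<close>
  then have "v * g v > 0" using threshold_pos[of "real p" v] p v by simp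
  then have "0 < g v" using v0 by (simp add: zero_less_mult_iff)
  moreover have "4 * real p / w \<le> 4 * real p / v" using v0 vw by (intro divide_left_mono) auto
  then have "g v < g w" using vw by (simp add: g_def)
  ultimately have "(g v)\<^sup>2 < (g w)\<^sup>2" by (intro power_strict_mono) auto
  moreover have "2 / w \<le> 2 / v" using v0 vw by (intro divide_left_mono) auto
  then have "8 * real p * (1 + 2 / w) \<le> 8 * real p * (1 + 2 / v)" using p0 by (intro mult_left_mono) auto
  then have "(g w)\<^sup>2 \<le> (g v)\<^sup>2" using g[of v] g[of w] v0 vw D by simp
  ultimately show False by simp
qed

text \<open>Intermediate value theorem between the threshold and \<open>10 * p + 1\<close>. At the
  threshold \<open>8 * P = s * s\<close> and \<open>v - 2 * P = s\<close> make the leading terms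
  cancel; at the right end the square is of order \<open>P ^ 4\<close> against a term of order
  \<open>P ^ 3\<close>.\<close>

lemma D_root_exists:
  assumes p: "2 \<le> p"
  shows "\<exists>c. 2 * real p + 1 + sqrt (8 * real p) \<le> c \<and> D p c = 0"
proof -
  define P where "P = real p"
  have P: "2 \<le> P" using p by (simp add: P_def)
  define s where "s = sqrt (8 * P)"
  have s: "s * s = 8 * P" "0 \<le> s" using P by (auto simp: s_def)
  define v where "v = 2 * P + s"
  have "s \<le> 8 * P"
    unfolding s_def using P by (intro real_le_lsqrt) (auto simp: power2_eq_square)
  then have v10: "v \<le> 10 * P" by (simp add: v_def)
  have "v\<^sup>2 - 2 * P * v - 4 * P = v * s - 4 * P" by (simp add: v_def power2_eq_square algebra_simps)
  then have "D p (v + 1) = (v * s - 4 * P)\<^sup>2 - s * s * v * (v + 2)"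
    unfolding D_alt P_def[symmetric] s(1) by simp
  also have "\<dots> = 16 * P\<^sup>2 - 8 * P * (v * s) - 2 * (s * s) * v" by (simp add: power2_eq_square algebra_simps)
  also have "\<dots> = - 8 * P * (v * s) - 16 * P * (v - P)" unfolding s(1) by (simp add: power2_eq_square algebra_simps)
  also have "\<dots> \<le> 0"
  proof -
    have "0 \<le> (8 * P) * (v * s)" "0 \<le> (16 * P) * (v - P)" using P s by (simp_all add: v_def)
    then show ?thesis by linarith
  qed
  finally have low: "D p (v + 1) \<le> 0" .
  have "78 * P\<^sup>2 \<le> (10 * P)\<^sup>2 - 2 * P * (10 * P) - 4 * P"
    using mult_right_mono[of 2 P P] P by (simp add: power2_eq_square)
  then have "(78 * P\<^sup>2)\<^sup>2 \<le> ((10 * P)\<^sup>2 - 2 * P * (10 * P) - 4 * P)\<^sup>2" by (intro power_mono) auto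
  moreover have "8 * P * (10 * P) * (10 * P + 2) \<le> 8 * P * (10 * P) * (11 * P)"
    using P by (intro mult_left_mono) auto
  moreover have "8 * P * (10 * P) * (11 * P) \<le> (78 * P\<^sup>2)\<^sup>2"
  proof -
    have "880 * P ^ 3 * 1 \<le> 880 * P ^ 3 * P" using P by (intro mult_left_mono) auto
    also have "880 * P ^ 3 * P = 880 * P ^ 4" by (simp add: power_numeral_reduce)
    also have "\<dots> \<le> 6084 * P ^ 4" by simp
    finally show ?thesis by (simp add: power_numeral_reduce algebra_simps)
  qed
  ultimately have "0 \<le> D p (10 * P + 1)" unfolding D_alt P_def[symmetric] by linarith
  moreover have "continuous_on {v + 1..10 * P + 1} (D p)"
    unfolding D_def by (intro continuous_intros)
  ultimately obtain c where "v + 1 \<le> c" "D p c = 0"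
    using IVT'[of "D p" "v + 1" 0 "10 * P + 1"] low v10 by auto
  then show ?thesis by (intro exI[of _ c]) (simp add: v_def s_def P_def)
qed

text \<open>The balance equation is a quadratic in \<open>r\<close>, and the formula for
  \<open>r\<close> is its positive root. It remains to see that \<open>p / (c - 1)\<close> solves
  this quadratic when \<open>D p c = 0\<close>.\<close>

lemma parameter_values:
  assumes p: "2 \<le> p" and c: "2 * real p + 1 + sqrt (8 * real p) \<le> c" "D p c = 0"
    and a: "a = (c - 1)\<^sup>2 / (2 * real p * (c + 1))"
    and r: "r = (sqrt ((real p * (a\<^sup>2 - 1) + 2)\<^sup>2 + 8 * real p * (a\<^sup>2 - 1) * (a - 1)) - 2)
             / (4 * (a\<^sup>2 - 1)) - real p / 4"
  shows "1 < a" and "r = real p / (c - 1)"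
    and "r * (2 + (2 * r + real p) * (a\<^sup>2 - 1)) = real p * (a - 1)"
proof -
  define P where "P = real p"
  define v where "v = c - 1"
  have P: "2 \<le> P" using p by (simp add: P_def)
  have v: "2 * P + sqrt (8 * P) \<le> v" using c by (simp add: v_def P_def)
  have v0: "0 < v" using v P by (smt (verit) real_sqrt_ge_zero)
  have av: "2 * P * (v + 2) * a = v\<^sup>2" 
  proof -
    have "v + 2 = c + 1" by (simp add: v_def)
    then have "a = v\<^sup>2 / (2 * P * (v + 2))" unfolding a by (simp only: P_def v_def)
    then show ?thesis using P v0 by simp
  qed
  have "2 * P * (v + 2) * 1 < 2 * P * (v + 2) * a"
    using threshold_pos[OF P v] unfolding av by (simp add: algebra_simps)
  then show a1: "1 < a" using P v0 by (simp add: mult_less_cancel_left)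
  have "0 = (v\<^sup>2 - 2 * P * v - 4 * P)\<^sup>2 - 8 * P * v * (v + 2)"
    using c(2) D_alt[of p v] by (simp add: v_def P_def)
  also have "v\<^sup>2 - 2 * P * v - 4 * P = 2 * P * (v + 2) * (a - 1)"
    unfolding av[symmetric] by (simp add: algebra_simps)
  also have "(2 * P * (v + 2) * (a - 1))\<^sup>2 - 8 * P * v * (v + 2)
      = 4 * P * (v + 2) * (P * (v + 2) * (a - 1)\<^sup>2 - 2 * v)"
    by (simp add: power2_eq_square algebra_simps)
  \<comment> \<open>\<open>D p c = 0\<close> after cancelling the positive factor
    \<open>4 * P * (v + 2)\<close>.\<close>
  finally have key: "P * (v + 2) * (a - 1)\<^sup>2 = 2 * v" using P v0 by auto
  define \<rho> where "\<rho> = P / v"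
  define A where "A = a\<^sup>2 - 1"
  have A0: "0 < A" using a1 by (simp add: A_def)
  \<comment> \<open>With \<open>v\<^sup>2 = 2 * P * (v + 2) * a\<close> and \<open>key\<close>, this
    is \<open>2 * a * (a - 1) = (a\<^sup>2 - 1) + (a - 1)\<^sup>2\<close> times
    \<open>P * (v + 2)\<close>.\<close>
  have "v\<^sup>2 * (a - 1) = P * (v + 2) * A + 2 * v"
    using key unfolding av[symmetric] A_def by (simp add: power2_eq_square algebra_simps)
  then have "P * (v\<^sup>2 * (a - 1)) = P * (P * (v + 2) * A + 2 * v)" by simp
  then have bal: "\<rho> * (2 + (2 * \<rho> + P) * A) = P * (a - 1)"
    using v0 by (simp add: \<rho>_def field_simps power2_eq_square)
  \<comment> \<open>The discriminant of the quadratic becomes a perfect square once its root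
    \<open>\<rho>\<close> is substituted.\<close>
  have "(P * A + 2)\<^sup>2 + 8 * P * A * (a - 1) = (P * A + 2)\<^sup>2 + 8 * A * (P * (a - 1))"
    by simp
  also have "\<dots> = (4 * A * \<rho> + P * A + 2)\<^sup>2"
    unfolding bal[symmetric] by (simp add: power2_eq_square algebra_simps)
  finally have "sqrt ((P * A + 2)\<^sup>2 + 8 * P * A * (a - 1)) = 4 * A * \<rho> + P * A + 2"
    using A0 P v0 by (simp add: \<rho>_def)
  then have "r = \<rho>"
    unfolding r P_def[symmetric] A_def[symmetric] using A0 by (simp add: field_simps)
  then show "r = real p / (c - 1)" "r * (2 + (2 * r + real p) * (a\<^sup>2 - 1)) = real p * (a - 1)"
    using bal by (simp_all add: \<rho>_def P_def v_def A_def)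
qed

theorem theorem2:
  fixes p :: nat
  assumes "even p" and "p \<ge> 2"
  shows "(\<exists>!c. c \<in> {2 * real p + 1 + sqrt (8 * real p)..} \<and> D p c = 0) \<and>
    (\<forall>c a r. c \<in> {2 * real p + 1 + sqrt (8 * real p)..} \<and> D p c = 0 \<and>
       a = (c - 1) ^ 2 / (2 * real p * (c + 1)) \<and>
       r = (sqrt ((real p * (a ^ 2 - 1) + 2) ^ 2 + 8 * real p * (a ^ 2 - 1) * (a - 1)) - 2)
             / (4 * (a ^ 2 - 1)) - real p / 4
       \<longrightarrow> 1 < a \<and> 0 \<le> r \<and> r \<le> 1 \<and> competitive_ratio p (even_algorithm p a r) = ereal c)"
proof (intro conjI allI impI)
  have "c = d" if "2 * real p + 1 + sqrt (8 * real p) \<le> c" "D p c = 0"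
    "2 * real p + 1 + sqrt (8 * real p) \<le> d" "D p d = 0" for c d
    using D_root_unique[of p "c - 1" "d - 1"] D_root_unique[of p "d - 1" "c - 1"] that assms(2)
    by (cases c d rule: linorder_cases) auto
  then show "\<exists>!c. c \<in> {2 * real p + 1 + sqrt (8 * real p)..} \<and> D p c = 0"
    using D_root_exists[OF assms(2)] by (metis atLeast_iff)
next
  fix c a r :: real
  assume *: "c \<in> {2 * real p + 1 + sqrt (8 * real p)..} \<and> D p c = 0 \<and>
       a = (c - 1) ^ 2 / (2 * real p * (c + 1)) \<and>
       r = (sqrt ((real p * (a ^ 2 - 1) + 2) ^ 2 + 8 * real p * (a ^ 2 - 1) * (a - 1)) - 2)
             / (4 * (a ^ 2 - 1)) - real p / 4"
  then have c: "2 * real p + 1 + sqrt (8 * real p) \<le> c" by simp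
  note pv = parameter_values[OF assms(2) c, of a r]
  have a: "1 < a" and r: "r = real p / (c - 1)"
    and bal: "r * (2 + (2 * r + real p) * (a\<^sup>2 - 1)) = real p * (a - 1)"
    using pv * by blast+
  \<comment> \<open>The threshold thus gives even \<open>r \<le> 1 / 2\<close>.\<close>
  have "2 * real p \<le> c - 1" using c by (smt (verit) of_nat_0_le_iff real_sqrt_ge_zero)
  then have r01: "0 < r" "r \<le> 1" using assms(2) by (auto simp: r)
  have "1 + real p / r = c" using assms(2) \<open>2 * real p \<le> c - 1\<close> by (simp add: r)
  then have "competitive_ratio p (even_algorithm p a r) = ereal c"
    using competitive_ratio_even_algorithm[OF assms a r01 bal] by simp
  with a r01 show "1 < a" "0 \<le> r" "r \<le> 1" "competitive_ratio p (even_algorithm p a r) = ereal c"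
    by auto
qed

end
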